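(* Let $sE-A\in\mathbb{K}[s]^{n\times m}$ be a matrix pencil such that $\operatorname{ran}\begin{bmatrix}E\\ A\end{bmatrix}=\mathcal{D}\mathcal{L}$ for some skew-adjoint linear relation $\mathcal{D}\subseteq\mathbb{K}^{2n}$ and some self-adjoint linear relation $\mathcal{L}\subseteq\mathbb{K}^{2n}$. If, additionally, $\operatorname{mul}\mathcal{D}=\{0\}$, then $sE-A$ is port-Hamiltonian in the sense of Mehl, Mehrmann and Wojtylak. Namely, there exist some $Q\in\mathbb{K}^{n\times m}$ and some skew-Hermitian $D\in\mathbb{K}^{n\times n}$ such that $A=DQ$ and $E^*Q=Q^*E$, and these matrices fulfill $\mathcal{D}=\operatorname{gr}D$ and $\mathcal{L}\supseteq\operatorname{ran}\begin{bmatrix}E\\ Q\end{bmatrix}$.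
   Context: $\mathbb{K}\in\{\mathbb{R},\mathbb{C}\}$, and $\mathbb{K}^n$ carries the inner product $\langle x,y\rangle=y^*x$. A linear relation in $\mathbb{K}^n$ is a linear subspace of $\mathbb{K}^{2n}\cong\mathbb{K}^n\times\mathbb{K}^n$. The multi-valued part is $\operatorname{mul}\mathcal{M}=\{y:(0,y)\in\mathcal{M}\}$. The graph of $M\in\mathbb{K}^{n\times n}$ is $\operatorname{gr}M=\{(x,Mx):x\in\mathbb{K}^n\}$. The product is $\mathcal{D}\mathcal{L}=\{(x,z) : \exists y\in\mathbb{K}^n,\ (x,y)\in\mathcal{L},\ (y,z)\in\mathcal{D}\}$. The adjoint is $\mathcal{M}^*=\{(x,y)\in\mathbb{K}^{2n} : \langle w,x\rangle=\langle v,y\rangle\ \forall (v,w)\in\mathcal{M}\}$. With $-\mathcal{M}=\{(x,-y):(x,y)\in\mathcal{M}\}$, $\mathcal{M}$ is self-adjoint if $\mathcal{M}=\mathcal{M}^*$ and skew-adjoint if $\mathcal{M}=-\mathcal{M}^*$. A pencil $sE-A\in\mathbb{K}[s]^{n\times m}$ is port-Hamiltonian in the sense of Mehl, Mehrmann and Wojtylak if there exist $Q\in\mathbb{K}^{n\times m}$ and $D\in\mathbb{K}^{n\times n}$ with $D+D^*\le0$ (negative semi-definite), $A=DQ$ and $E^*Q=Q^*E$. *)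

theory Defs
  imports
    "HOL-Analysis.Analysis"
    "HOL-Computational_Algebra.Polynomial"
begin

text \<open>
  The scalar fields \<open>\<real>\<close> and \<open>\<complex>\<close> are treated uniformly by a type class that provides conjugation.
  Up to isomorphism \<open>\<real>\<close> (with trivial conjugation) and \<open>\<complex>\<close> (with \<^const>\<open>cnj\<close>) are the only
  instances, see \<open>real_or_complex_cases\<close> below.
\<close>

class real_or_complex = real_normed_field +
  fixes conjugate :: "'a \<Rightarrow> 'a"
  assumes conjugate_add: "conjugate (x + y) = conjugate x + conjugate y"
    and conjugate_mult: "conjugate (x * y) = conjugate x * conjugate y"
    and mult_conjugate_self_scaleR: "x * conjugate x = scaleR ((norm x)\<^sup>2) 1"

instantiation real :: real_or_complex
begin
definition conjugate_real :: "real \<Rightarrow> real" where "conjugate_real x = x"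
instance by standard (auto simp: conjugate_real_def power2_eq_square)
end

instantiation complex :: real_or_complex
begin
definition conjugate_complex :: "complex \<Rightarrow> complex" where "conjugate_complex = cnj"
instance by standard (auto simp: conjugate_complex_def complex_norm_square[symmetric]
    scaleR_conv_of_real simp del: of_real_power)
end

lemma mult_conjugate_self: "x * conjugate x = (of_real ((norm x)\<^sup>2) :: 'k::real_or_complex)"
  by (simp add: mult_conjugate_self_scaleR of_real_def)

lemma conjugate_of_real [simp]: "conjugate (of_real r :: 'k::real_or_complex) = of_real r"
proof (cases "r = 0")
  case True
  have "conjugate (0 + 0 :: 'k) = conjugate 0 + conjugate 0" by (rule conjugate_add)
  then show ?thesis using True by simp
next
  case False
  have "of_real r * conjugate (of_real r :: 'k) = of_real r * of_real r"
    using mult_conjugate_self[of "of_real r :: 'k"] by (simp add: power2_eq_square)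
  then show ?thesis using False by simp
qed

lemma conjugate_conjugate [simp]: "conjugate (conjugate x) = (x :: 'k::real_or_complex)"
proof (cases "x = 0")
  case True
  then show ?thesis using conjugate_of_real[of 0, where 'k = 'k] by simp
next
  case False
  have "conjugate (x * conjugate x) = x * conjugate x"
    by (simp only: mult_conjugate_self conjugate_of_real)
  then have "conjugate x * conjugate (conjugate x) = conjugate x * x"
    by (simp add: conjugate_mult mult.commute)
  moreover have "conjugate x \<noteq> 0"
    using mult_conjugate_self[of x] False by auto
  ultimately show ?thesis by simp
qed

lemma add_conjugate_self_real:
  "\<exists>r. (x :: 'k::real_or_complex) + conjugate x = of_real r"
proof -
  have c1: "conjugate (1 :: 'k) = 1" using conjugate_of_real[of 1, where 'k = 'k] by simp
  have "(1 + x) * conjugate (1 + x) = 1 + (x + conjugate x) + x * conjugate x"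
    by (simp add: conjugate_add c1 algebra_simps)
  then have "x + conjugate x = of_real ((norm (1 + x))\<^sup>2 - 1 - (norm x)\<^sup>2)"
    unfolding mult_conjugate_self by (simp add: algebra_simps)
  then show ?thesis by blast
qed

lemma conjugate_fixed_real:
  assumes "conjugate x = (x :: 'k::real_or_complex)"
  shows "\<exists>r. x = of_real r"
proof -
  obtain r where "x + x = of_real r" using add_conjugate_self_real[of x] assms by auto
  then have "x = of_real (r / 2)" by (simp add: field_simps)
  then show ?thesis by blast
qed

lemma real_or_complex_cases:
  "(\<forall>x :: 'k::real_or_complex. conjugate x = x \<and> (\<exists>r. x = of_real r)) \<or>
   (\<exists>i :: 'k. i * i = - 1 \<and> conjugate i = - i \<and> (\<forall>x. \<exists>a b. x = of_real a + of_real b * i))"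
proof (cases "\<forall>x :: 'k. conjugate x = x")
  case True
  then show ?thesis using conjugate_fixed_real by blast
next
  case False
  then obtain x :: 'k where x: "conjugate x \<noteq> x" by blast
  have cm: "conjugate (- y) = - conjugate y" for y :: 'k
    using conjugate_mult[of "of_real (- 1)" y] by (simp del: conjugate_of_real)
      (metis conjugate_of_real mult_minus1 of_real_1 of_real_minus)
  have cd: "conjugate (y - z) = conjugate y - conjugate z" for y z :: 'k
    using conjugate_add[of y "- z"] cm by simp
  define y where "y = x - conjugate x"
  have y: "y \<noteq> 0" "conjugate y = - y" using x by (auto simp: y_def cd)
  define i where "i = of_real (1 / norm y) * y"
  have ci: "conjugate i = - i"
    unfolding i_def conjugate_mult conjugate_of_real y(2) by simp
  have ni: "norm i = 1" using y(1) by (simp add: i_def norm_mult norm_divide)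
  have ii: "i * i = - 1"
    using mult_conjugate_self[of i] ni ci by (simp add: minus_equation_iff)
  have "\<exists>a b. z = of_real a + of_real b * i" for z
  proof -
    obtain a where a: "z + conjugate z = of_real a" using add_conjugate_self_real by blast
    have "conjugate ((z - conjugate z) * i) = (z - conjugate z) * i"
      by (simp add: conjugate_mult cd ci algebra_simps)
    then obtain b where b: "(z - conjugate z) * i = of_real b" using conjugate_fixed_real by blast
    have "(z - conjugate z) * (i * i) = of_real b * i" using b by (simp add: mult.assoc[symmetric])
    then have "z - conjugate z = - of_real b * i" unfolding ii
      by (metis minus_mult_left minus_minus mult_minus1_right)
    with a have "z + z = of_real a + - of_real b * i"
      by (metis add_diff_cancel_left' diff_add_eq diff_diff_eq2 add.commute)
    then have "z = of_real (a / 2) + of_real (- b / 2) * i" by (simp add: field_simps)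
    then show ?thesis by blast
  qed
  with ii ci show ?thesis by blast
qed

text \<open>\<open>cinner x y = y\<^sup>* x\<close>, linear in the first argument.\<close>

definition cinner :: "('k::real_or_complex)^'n \<Rightarrow> 'k^'n \<Rightarrow> 'k" where
  "cinner x y = (\<Sum>i\<in>UNIV. conjugate (y $ i) * x $ i)"

definition conj_transpose :: "('k::real_or_complex)^'m^'n \<Rightarrow> 'k^'n^'m" where
  "conj_transpose M = map_matrix conjugate (transpose M)"

definition skew_hermitian :: "('k::real_or_complex)^'n^'n \<Rightarrow> bool" where
  "skew_hermitian M \<longleftrightarrow> conj_transpose M = - M"

text \<open>The existential expresses that \<open>x\<^sup>* M x\<close> is a non-positive real number.\<close>

definition neg_semidef :: "('k::real_or_complex)^'n^'n \<Rightarrow> bool" where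
  "neg_semidef M \<longleftrightarrow>
     conj_transpose M = M \<and> (\<forall>x. \<exists>r::real. r \<le> 0 \<and> cinner (M *v x) x = of_real r)"

text \<open>The space \<open>\<bbbK>\<^sup>2\<^sup>n\<close> is represented as the product \<open>\<bbbK>\<^sup>n \<times> \<bbbK>\<^sup>n\<close>; its subspaces over
  \<open>\<bbbK>\<close> are \<open>prodvec.subspace\<close> (the class-based \<^const>\<open>subspace\<close> is only real-linear).\<close>

definition scale_prod :: "'k::field \<Rightarrow> ('k^'n) \<times> ('k^'n) \<Rightarrow> ('k^'n) \<times> ('k^'n)" where
  "scale_prod c p = (c *s fst p, c *s snd p)"

global_interpretation prodvec: vector_space scale_prod
  by standard (auto simp: scale_prod_def vec.scale_right_distrib vec.scale_left_distrib)

definition linear_relation :: "(('k::field^'n) \<times> ('k^'n)) set \<Rightarrow> bool" where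
  "linear_relation M \<longleftrightarrow> prodvec.subspace M"

definition multivalued_part :: "(('k::zero^'n) \<times> ('k^'n)) set \<Rightarrow> ('k^'n) set" where
  "multivalued_part M = {y. (0, y) \<in> M}"

definition graph_rel :: "('k::semiring_1)^'n^'n \<Rightarrow> (('k^'n) \<times> ('k^'n)) set" where
  "graph_rel M = {(x, M *v x) | x. True}"

text \<open>\<open>rel_product D L\<close> is \<open>D\<close> after \<open>L\<close>, that is, \<open>relcomp\<close> with its arguments swapped.\<close>

definition rel_product ::
    "(('k^'n) \<times> ('k^'n)) set \<Rightarrow> (('k^'n) \<times> ('k^'n)) set \<Rightarrow> (('k^'n) \<times> ('k^'n)) set" where
  "rel_product D L = L O D"

definition rel_adjoint ::
    "(('k::real_or_complex^'n) \<times> ('k^'n)) set \<Rightarrow> (('k^'n) \<times> ('k^'n)) set" where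
  "rel_adjoint M = {(x, y). \<forall>(v, w)\<in>M. cinner w x = cinner v y}"

definition rel_uminus :: "(('k::ab_group_add^'n) \<times> ('k^'n)) set \<Rightarrow> (('k^'n) \<times> ('k^'n)) set" where
  "rel_uminus M = {(x, - y) | x y. (x, y) \<in> M}"

definition self_adjoint_rel :: "(('k::real_or_complex^'n) \<times> ('k^'n)) set \<Rightarrow> bool" where
  "self_adjoint_rel M \<longleftrightarrow> M = rel_adjoint M"

definition skew_adjoint_rel :: "(('k::real_or_complex^'n) \<times> ('k^'n)) set \<Rightarrow> bool" where
  "skew_adjoint_rel M \<longleftrightarrow> M = rel_uminus (rel_adjoint M)"

text \<open>The range of the block matrix with \<open>E\<close> stacked on top of \<open>A\<close>.\<close>

definition ran_stacked :: "('k::semiring_1)^'m^'n \<Rightarrow> 'k^'m^'n \<Rightarrow> (('k^'n) \<times> ('k^'n)) set" where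
  "ran_stacked E A = range (\<lambda>x. (E *v x, A *v x))"

text \<open>The pencil \<open>s E - A\<close> as a matrix of polynomials in \<open>s\<close>; it determines \<open>E\<close> and \<open>A\<close>.\<close>

definition matrix_pencil :: "('k::ab_group_add)^'m^'n \<Rightarrow> 'k^'m^'n \<Rightarrow> 'k poly^'m^'n" where
  "matrix_pencil E A = (\<chi> i j. [: - (A $ i $ j), E $ i $ j :])"

text \<open>Port-Hamiltonian in the sense of Mehl, Mehrmann and Wojtylak.\<close>

definition port_hamiltonian_MMW :: "('k::real_or_complex) poly^'m^'n \<Rightarrow> bool" where
  "port_hamiltonian_MMW P \<longleftrightarrow>
     (\<exists>(E :: 'k^'m^'n) (A :: 'k^'m^'n) (Q :: 'k^'m^'n) (D :: 'k^'n^'n).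
        P = matrix_pencil E A \<and> neg_semidef (D + conj_transpose D) \<and> A = D ** Q \<and>
        conj_transpose E ** Q = conj_transpose Q ** E)"

end

theory Submission
  imports Defs
begin

text \<open>
  If \<open>y\<close> is orthogonal to the domain of the skew-adjoint relation \<open>\<D>\<close>, then \<open>(0, y) \<in> \<D>\<close>.
  Hence a trivial multi-valued part forces the domain to be all of \<open>\<bbbK>\<^sup>n\<close>, and \<open>\<D>\<close> is the graph
  of a matrix \<open>D\<close>. The columns of \<open>Q\<close> are the intermediate vectors \<open>q\<close> with
  \<open>(E e\<^sub>j, q) \<in> \<L>\<close> and \<open>(q, A e\<^sub>j) \<in> \<D>\<close>; by linearity \<open>\<L>\<close> contains all pairs \<open>(E x, Q x)\<close> and
  \<open>\<D>\<close> all pairs \<open>(Q x, A x)\<close>, and both matrix identities are symmetry properties of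
  \<open>\<D>\<close> and \<open>\<L>\<close>.
\<close>

lemma conjugate_0 [simp]: "conjugate (0 :: 'k::real_or_complex) = 0"
  using conjugate_of_real[of 0, where 'k = 'k] by simp

lemma conjugate_minus [simp]: "conjugate (- x) = - conjugate (x :: 'k::real_or_complex)"
  using conjugate_add[of x "- x"] by (simp add: add_eq_0_iff)

lemma conjugate_sum:
  "conjugate (\<Sum>i\<in>S. f i) = (\<Sum>i\<in>S. conjugate (f i :: 'k::real_or_complex))"
  by (induction S rule: infinite_finite_induct) (auto simp: conjugate_add)

lemma cinner_0_right [simp]: "cinner x 0 = 0"
  by (simp add: cinner_def)

lemma cinner_minus_right [simp]: "cinner x (- y) = - cinner x y"
  by (simp add: cinner_def sum_negf)

lemma cinner_axis: "cinner (axis i 1) y = conjugate (y $ i)"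
  by (simp add: cinner_def axis_def if_distrib sum.delta cong: if_cong)

lemma cinner_right_ext:
  assumes "\<And>x. cinner x y = cinner x z"
  shows "y = z"
proof -
  have "y $ i = z $ i" for i
    using assms[of "axis i 1"] by (metis cinner_axis conjugate_conjugate)
  then show ?thesis by (simp add: vec_eq_iff)
qed

lemma cinner_matrix_vector_mult:
  "cinner (M *v x) y = cinner x (conj_transpose M *v y)"
proof -
  have "cinner (M *v x) y = (\<Sum>i\<in>UNIV. \<Sum>j\<in>UNIV. conjugate (y $ i) * (M $ i $ j * x $ j))"
    by (simp add: cinner_def matrix_vector_mult_def sum_distrib_left)
  also have "\<dots> = (\<Sum>j\<in>UNIV. \<Sum>i\<in>UNIV. conjugate (y $ i) * (M $ i $ j * x $ j))"
    by (rule sum.swap)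
  also have "\<dots> = cinner x (conj_transpose M *v y)"
    by (simp add: cinner_def matrix_vector_mult_def conj_transpose_def transpose_def
        map_matrix_def conjugate_sum conjugate_mult sum_distrib_left sum_distrib_right mult_ac)
  finally show ?thesis .
qed

text \<open>Moving the adjoints across the form reduces the matrix identity to equality of two
  sesquilinear forms, which is how symmetry of a relation supplies it.\<close>

lemma conj_transpose_mult_eqI:
  assumes "\<And>x z. cinner (E *v x) (Q *v z) = cinner (F *v x) (R *v z)"
  shows "conj_transpose E ** Q = conj_transpose F ** R"
  unfolding matrix_eq
proof (intro allI cinner_right_ext)
  fix x z
  show "cinner x ((conj_transpose E ** Q) *v z) = cinner x ((conj_transpose F ** R) *v z)"
    using assms[of x z]
    by (simp add: cinner_matrix_vector_mult matrix_vector_mul_assoc)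
qed

text \<open>A vector \<open>b\<close> outside \<open>W\<close> is separated from \<open>W\<close> by
  a linear functional that vanishes on \<open>W\<close> but not at \<open>b\<close>. Writing this
  functional as \<open>cinner _ y\<close> yields a nonzero \<open>y\<close> orthogonal to
  \<open>W\<close>.\<close>

lemma subspace_orthogonal_trivial_UNIV:
  fixes W :: "('k::real_or_complex^'n) set"
  assumes W: "vec.subspace W"
    and orth: "\<And>y. (\<And>v. v \<in> W \<Longrightarrow> cinner v y = 0) \<Longrightarrow> y = 0"
  shows "W = UNIV"
proof (rule ccontr)
  assume "W \<noteq> UNIV"
  then obtain b where b: "b \<notin> W" by blast
  obtain B where B: "B \<subseteq> W" "vec.independent B" "W \<subseteq> vec.span B"
    using vec.basis_exists[of W] by metis
  have sp: "vec.span B = W"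
    using B W by (meson subset_antisym vec.span_minimal)
  have "vec.independent (insert b B)"
    using B(2) b sp by (simp add: vec.independent_insertI)
  \<comment> \<open>Since \<open>B\<close> spans \<open>W\<close>, the extension \<open>f\<close>
    kills \<open>W\<close> and fixes \<open>b\<close>; one coordinate of \<open>f\<close> will serve
    as the functional.\<close>
  then obtain f where f: "Vector_Spaces.linear (*s) (*s) f"
      and fB: "\<And>x. x \<in> insert b B \<Longrightarrow> f x = (if x = b then b else 0)"
    using vec.linear_independent_extend[of "insert b B" "\<lambda>x. if x = b then b else 0"] by metis
  have "\<And>x. x \<in> B \<Longrightarrow> f x = 0" using fB b B(1) by auto
  then have f0: "f v = 0" if "v \<in> W" for v
    using vec.linear_eq_0_on_span[OF f] that sp by metis
  have fM: "matrix f *v x = f x" for x using f by (rule matrix_works)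
  have "b \<noteq> 0" using b vec.subspace_0[OF W] by blast
  then obtain i where i: "b $ i \<noteq> 0" by (auto simp: vec_eq_iff)
  \<comment> \<open>The Riesz vector of the functional taking \<open>x\<close> to
    \<open>f x $ i\<close>; the choice of \<open>i\<close> makes the functional nonzero at
    \<open>b\<close>.\<close>
  define y where "y = conj_transpose (matrix f) *v axis i 1"
  have y: "cinner x y = f x $ i" for x
  proof -
    have "cinner x y = cinner (f x) (axis i 1)"
      by (simp add: y_def cinner_matrix_vector_mult[symmetric] fM)
    also have "\<dots> = f x $ i"
      using conjugate_of_real[of 1, where 'k = 'k]
      by (simp add: cinner_def axis_def if_distrib[of conjugate]
          if_distrib[of "\<lambda>u. u * _"] sum.delta cong: if_cong)
    finally show ?thesis .
  qed
  have "y = 0" using y f0 by (intro orth) simp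
  with y[of b] fB[of b] i show False by simp
qed

text \<open>\<open>E *v x\<close> and \<open>Q *v x\<close> combine their columns with the same
  coefficients \<open>x $ j\<close>. Thus pairs chosen for unit vectors alone can be assembled into
  a matrix.\<close>

lemma ran_stacked_subsetI:
  fixes M :: "(('k::field^'n) \<times> ('k^'n)) set" and E Q :: "'k^'m^'n"
  assumes M: "prodvec.subspace M" and cols: "\<And>j. (column j E, column j Q) \<in> M"
  shows "ran_stacked E Q \<subseteq> M"
proof -
  have fst_sum: "fst (sum f S) = (\<Sum>j\<in>S. fst (f j))"
    and snd_sum: "snd (sum f S) = (\<Sum>j\<in>S. snd (f j))" for f :: "'m \<Rightarrow> ('k^'n) \<times> ('k^'n)" and S
    by (induction S rule: infinite_finite_induct) auto
  have "(E *v x, Q *v x) \<in> M" for x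
  proof -
    have "(E *v x, Q *v x) = (\<Sum>j\<in>UNIV. scale_prod (x $ j) (column j E, column j Q))"
      by (simp add: prod_eq_iff fst_sum snd_sum scale_prod_def matrix_mult_sum)
    also have "\<dots> \<in> M"
      by (intro prodvec.subspace_sum[OF M] prodvec.subspace_scale[OF M] cols)
    finally show ?thesis .
  qed
  then show ?thesis by (auto simp: ran_stacked_def)
qed

lemma self_adjoint_relD:
  assumes "self_adjoint_rel L" "(v, w) \<in> L" "(x, y) \<in> L"
  shows "cinner w x = cinner v y"
  using assms unfolding self_adjoint_rel_def rel_adjoint_def by blast

text \<open>The sign in \<open>rel_uminus\<close> moves into the form. Left to right is
  skew-symmetry between any two pairs of \<open>D\<close>; right to left is maximality, which places
  new pairs in \<open>D\<close>.\<close>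

lemma skew_adjoint_rel_iff:
  assumes "skew_adjoint_rel D"
  shows "(x, y) \<in> D \<longleftrightarrow> (\<forall>(v, w)\<in>D. cinner w x = - cinner v y)"
proof -
  have "(x, y) \<in> rel_uminus (rel_adjoint D) \<longleftrightarrow> (x, - y) \<in> rel_adjoint D"
    by (force simp: rel_uminus_def)
  then have "(x, y) \<in> D \<longleftrightarrow> (x, - y) \<in> rel_adjoint D"
    using assms unfolding skew_adjoint_rel_def by argo
  then show ?thesis by (simp add: rel_adjoint_def)
qed

lemma skew_adjoint_rel_Domain:
  fixes D :: "(('k::real_or_complex^'n) \<times> ('k^'n)) set"
  assumes lin: "linear_relation D" and skew: "skew_adjoint_rel D"
    and mul: "multivalued_part D = {0}"
  shows "Domain D = UNIV"
proof (rule subspace_orthogonal_trivial_UNIV)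
  have D: "prodvec.subspace D" using lin by (simp add: linear_relation_def)
  show "vec.subspace (Domain D)"
  proof (rule vec.subspaceI)
    show "0 \<in> Domain D"
      using prodvec.subspace_0[OF D] by (auto simp: zero_prod_def)
    show "x + y \<in> Domain D" if xy: "x \<in> Domain D" "y \<in> Domain D" for x y
    proof -
      obtain a b where "(x, a) \<in> D" "(y, b) \<in> D" using xy by blast
      from prodvec.subspace_add[OF D this] show ?thesis by auto
    qed
    show "c *s x \<in> Domain D" if x: "x \<in> Domain D" for c x
    proof -
      obtain a where "(x, a) \<in> D" using x by blast
      from prodvec.subspace_scale[OF D this, of c] show ?thesis by (auto simp: scale_prod_def)
    qed
  qed
  show "y = 0" if "\<And>v. v \<in> Domain D \<Longrightarrow> cinner v y = 0" for y
  proof -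
    \<comment> \<open>With first component \<open>0\<close> the left side of the criterion vanishes,
      so what remains is orthogonality of \<open>y\<close> to the domain.\<close>
    have "(0, y) \<in> D"
      using that by (auto simp: skew_adjoint_rel_iff[OF skew, of 0 y])
    then show ?thesis using mul by (auto simp: multivalued_part_def)
  qed
qed

lemma skew_adjoint_rel_eq_graph:
  fixes D :: "(('k::real_or_complex^'n) \<times> ('k^'n)) set"
  assumes lin: "linear_relation D" and skew: "skew_adjoint_rel D"
    and mul: "multivalued_part D = {0}"
  obtains M :: "'k^'n^'n" where "skew_hermitian M" "D = graph_rel M"
proof -
  have D: "prodvec.subspace D" using lin by (simp add: linear_relation_def)
  have "\<forall>j. \<exists>y. (axis j 1, y) \<in> D"
    using skew_adjoint_rel_Domain[OF assms] by (metis Domain.cases UNIV_I)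
  then obtain d where d: "\<And>j. (axis j 1, d j) \<in> D" by metis
  define M :: "'k^'n^'n" where "M = (\<chi> i j. d j $ i)"
  have cM: "column j M = d j" for j by (simp add: M_def column_def vec_eq_iff)
  have c1: "column j (mat 1 :: 'k^'n^'n) = axis j 1" for j
    by (simp add: column_def mat_def axis_def vec_eq_iff)
  \<comment> \<open>Stacking the identity on \<open>M\<close> gives exactly the graph of
    \<open>M\<close>.\<close>
  have "ran_stacked (mat 1) M \<subseteq> D"
    by (rule ran_stacked_subsetI[OF D]) (simp add: cM c1 d)
  then have M: "(x, M *v x) \<in> D" for x
    by (auto simp: ran_stacked_def)
  have "y = M *v x" if "(x, y) \<in> D" for x y
  proof -
    \<comment> \<open>Two pairs with the same first component differ by an element of the
      multi-valued part, so \<open>D\<close> is single-valued.\<close>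
    have "(0, y - M *v x) \<in> D"
      using prodvec.subspace_diff[OF D that M[of x]] by simp
    then have "y - M *v x \<in> multivalued_part D" by (simp add: multivalued_part_def)
    then show ?thesis using mul by simp
  qed
  with M have "D = graph_rel M" by (auto simp: graph_rel_def)
  moreover have "conj_transpose M = - M"
    unfolding matrix_eq
  proof (intro allI cinner_right_ext)
    fix x z
    have "(- M) *v z = - (M *v z)"
      by (simp add: matrix_vector_mult_def vec_eq_iff sum_negf)
    moreover have "cinner (M *v x) z = - cinner x (M *v z)"
      using M[of z] M[of x] skew_adjoint_rel_iff[OF skew, of z "M *v z"] by blast
    ultimately show "cinner x (conj_transpose M *v z) = cinner x (- M *v z)"
      by (simp add: cinner_matrix_vector_mult)
  qed
  ultimately show ?thesis using that by (simp add: skew_hermitian_def)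
qed

theorem proposition4p6:
  fixes E A :: "('k::real_or_complex)^'m^'n"
    and \<D> \<L> :: "(('k^'n) \<times> ('k^'n)) set"
  assumes "linear_relation \<D>" and "skew_adjoint_rel \<D>"
    and "linear_relation \<L>" and "self_adjoint_rel \<L>"
    and "ran_stacked E A = rel_product \<D> \<L>"
    and "multivalued_part \<D> = {0}"
  shows "port_hamiltonian_MMW (matrix_pencil E A) \<and>
    (\<exists>(Q :: 'k^'m^'n) (D :: 'k^'n^'n). skew_hermitian D \<and> A = D ** Q \<and>
       conj_transpose E ** Q = conj_transpose Q ** E \<and>
       \<D> = graph_rel D \<and> ran_stacked E Q \<subseteq> \<L>)"
proof -
  obtain D :: "'k^'n^'n" where D: "skew_hermitian D" "\<D> = graph_rel D"
    using skew_adjoint_rel_eq_graph assms(1,2,6) by blast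
  have "(column j E, column j A) \<in> rel_product \<D> \<L>" for j
    unfolding assms(5)[symmetric] ran_stacked_def
    by (rule image_eqI[of _ _ "axis j 1"])
      (simp_all add: column_def matrix_vector_mult_def axis_def vec_eq_iff
        if_distrib[of "\<lambda>u. _ * u"] cong: if_cong)
  then have "\<forall>j. \<exists>q. (column j E, q) \<in> \<L> \<and> (q, column j A) \<in> \<D>"
    unfolding rel_product_def by blast
  then obtain q where q: "\<And>j. (column j E, q j) \<in> \<L>" "\<And>j. (q j, column j A) \<in> \<D>"
    by metis
  \<comment> \<open>The intermediate vectors need not be unique; choosing them only for the columns
    of \<open>E\<close> and \<open>A\<close> makes the dependence on \<open>x\<close>
    linear.\<close>
  define Q :: "'k^'m^'n" where "Q = (\<chi> i j. q j $ i)"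
  have cQ: "column j Q = q j" for j by (simp add: Q_def column_def vec_eq_iff)
  have EQ: "ran_stacked E Q \<subseteq> \<L>" and QA: "ran_stacked Q A \<subseteq> \<D>"
    using assms(1,3) by (simp_all add: ran_stacked_subsetI cQ q linear_relation_def)
  have "A *v x = (D ** Q) *v x" for x
  proof -
    have "(Q *v x, A *v x) \<in> graph_rel D" using QA D(2) by (auto simp: ran_stacked_def)
    then show ?thesis by (simp add: graph_rel_def matrix_vector_mul_assoc)
  qed
  then have A: "A = D ** Q" by (simp add: matrix_eq)
  have H: "conj_transpose E ** Q = conj_transpose Q ** E"
  proof (rule conj_transpose_mult_eqI)
    fix x z
    have "(E *v y, Q *v y) \<in> \<L>" for y using EQ by (auto simp: ran_stacked_def)
    then show "cinner (E *v x) (Q *v z) = cinner (Q *v x) (E *v z)"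
      using self_adjoint_relD[OF assms(4)] by metis
  qed
  \<comment> \<open>For skew-Hermitian \<open>D\<close> the sum \<open>D + conj_transpose D\<close>
    is zero, so semi-definiteness only has to be checked for the zero matrix.\<close>
  have "conj_transpose (0 :: 'k^'n^'n) = 0"
    by (simp add: conj_transpose_def map_matrix_def transpose_def vec_eq_iff)
  moreover have "cinner ((0 :: 'k^'n^'n) *v x) x = of_real 0" for x
    by (simp add: cinner_def)
  ultimately have "neg_semidef (0 :: 'k^'n^'n)"
    unfolding neg_semidef_def by blast
  then have "neg_semidef (D + conj_transpose D)" using D(1) by (simp add: skew_hermitian_def)
  then have "port_hamiltonian_MMW (matrix_pencil E A)"
    unfolding port_hamiltonian_MMW_def using A H by (intro exI[of _ E] exI[of _ A] exI[of _ Q] exI[of _ D]) simp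
  with A H D EQ show ?thesis by blast
qed

end
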